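(* Let $k$ be a natural number, let $m\le\left\lfloor\frac k2\right\rfloor-1$ be a natural number ($m\ge1$), and let $z=(z_0,\dots,z_{k-1})\in\mathbb C^k$ satisfy $\sum_{\nu=0}^{k-1}z_\nu=0$. Then the following inequalities hold. (1) $$\sum_{l=0}^mc_{m,l}\left\|z^{(l)}\right\|^2\le\frac1{4\sin^2\left(\frac{(m+1)\pi}k\right)}\sum_{l=0}^mc_{m,l}\left\|z^{(l+1)}\right\|^2 .$$ (2) $$ \begin{aligned} &S_{m,0}\left(\|\dot z\|^2-4\sin^2\left(\frac\pi k\right)\|z\|^2\right)+\sum_{l=1}^{m-1}S_{m,l}\left\|\tau z^{(l+1)}+4\sin^2\left(\frac\pi k\right)z^{(l-1)}\right\|^2\\ &\le\frac1{4\sin^2\left(\frac{(m+1)\pi}k\right)}\left[4\sin^2\left(\frac\pi k\right)S_{m,0}\left(\|\dot z\|^2-4\sin^2\left(\frac\pi k\right)\|z\|^2\right)+\sum_{l=0}^{m-1}S_{m,l}\left\|\tau z^{(l+2)}+4\sin^2\left(\frac\pi k\right)z^{(l)}\right\|^2\right]. \end{aligned} $$ For each of the two inequalities, equality holds if and only if $z=\sum_{0<|\nu|\le m+1}\zeta_\nu R_\nu$, i.e. $z$ is a linear combination of the vectors $R_\nu$ with $0<|\nu|\le m+1$.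
   Context: $\|\cdot\|$ is the norm of the Hermitian inner product $\langle z,w\rangle=\sum_{\nu=0}^{k-1}z_\nu\overline{w_\nu}$ on $\mathbb C^k$. The derivative (first difference) of $z$ is $\dot z=(z_1-z_0,z_2-z_1,\dots,z_0-z_{k-1})$, and $z^{(j)}$ is its $j$-fold iterate ($z^{(0)}=z$). The cyclic shift is $\tau z=(z_{k-1},z_0,z_1,\dots,z_{k-2})$. $R_\nu=(1,\omega^\nu,\omega^{2\nu},\dots,\omega^{(k-1)\nu})$ with $\omega=e^{2\pi i/k}$; the $\zeta_\nu=\frac1k\langle z,R_\nu\rangle$ are the Fourier coefficients of $z$. Indices $\nu$ are read modulo $k$ (so $\zeta_{-\nu}=\zeta_{k-\nu}$ and $R_{-\nu}=R_{k-\nu}$), and the condition $0<|\nu|\le m+1$ describes the set of residues $\nu\in\{1,\dots,m+1\}\cup\{k-m-1,\dots,k-1\}$, each counted once. Constants: $c_{m,l}$ are defined by $\prod_{j=1}^m\left(x-4\sin^2\left(\frac{j\pi}k\right)\right)=\sum_{l=0}^mc_{m,l}x^l$. With $P_1(x)=1$ and $P_m(x)=\prod_{j=2}^m\left(x-4\sin^2\left(\frac{j\pi}k\right)\right)$ for $m\ge2$, $S_{m,0}=P_m\left(4\sin^2\left(\frac\pi k\right)\right)$ and $S_{m,1},\dots,S_{m,m-1}$ are defined by $$\frac{P_m(x)-P_m\left(4\sin^2\left(\frac\pi k\right)\right)}{x-4\sin^2\left(\frac\pi k\right)}=\sum_{l=1}^{m-1}S_{m,l}\,x^{l-1}$$ (none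 for $m=1$). *)

theory Defs
  imports
    Complex_Main
    "HOL-Computational_Algebra.Polynomial"
    "Jordan_Normal_Form.Matrix"
begin

(* Vectors of C^k are elements of carrier_vec k :: complex vec, with entries z $ 0, ..., z $ (k-1);
   v \<bullet>c w is the Hermitian product, linear in v and conjugate-linear in w. *)

definition cnorm :: "complex vec \<Rightarrow> real" where
  "cnorm z = sqrt (Re (z \<bullet>c z))"

definition cdiff :: "complex vec \<Rightarrow> complex vec" where
  "cdiff z = vec (dim_vec z) (\<lambda>i. z $ ((i + 1) mod dim_vec z) - z $ i)"

definition cshift :: "complex vec \<Rightarrow> complex vec" where
  "cshift z = vec (dim_vec z) (\<lambda>i. z $ ((i + dim_vec z - 1) mod dim_vec z))"

definition fourier_vec :: "nat \<Rightarrow> nat \<Rightarrow> complex vec" where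
  "fourier_vec k \<nu> = vec k (\<lambda>j. exp (2 * of_real pi * \<i> / of_nat k) ^ (j * \<nu>))"

definition fourier_coeff :: "complex vec \<Rightarrow> nat \<Rightarrow> complex" where
  "fourier_coeff z \<nu> = 1 / of_nat (dim_vec z) * (z \<bullet>c fourier_vec (dim_vec z) \<nu>)"

(* The residues \<nu> modulo k with 0 < |\<nu>| \<le> n, by representatives in {0..<k}, for n < k. *)
definition low_freqs :: "nat \<Rightarrow> nat \<Rightarrow> nat set" where
  "low_freqs k n = {1..n} \<union> {k - n..k - 1}"

definition lam :: "nat \<Rightarrow> nat \<Rightarrow> real" where
  "lam k j = 4 * (sin (real j * pi / real k))\<^sup>2"

definition c_coeff :: "nat \<Rightarrow> nat \<Rightarrow> nat \<Rightarrow> real" where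
  "c_coeff k m l = coeff (\<Prod>j=1..m. [:- lam k j, 1:]) l"

(* For m = 1 this is the empty product 1. *)
definition P_poly :: "nat \<Rightarrow> nat \<Rightarrow> real poly" where
  "P_poly k m = (\<Prod>j=2..m. [:- lam k j, 1:])"

(* For l > 0 the polynomial division is exact; see S_coeff_eq. *)
definition S_coeff :: "nat \<Rightarrow> nat \<Rightarrow> nat \<Rightarrow> real" where
  "S_coeff k m l =
    (if l = 0 then poly (P_poly k m) (lam k 1)
     else coeff ((P_poly k m - [:poly (P_poly k m) (lam k 1):]) div [:- lam k 1, 1:]) (l - 1))"

lemma poly_eq_sum_lessThan:
  fixes p :: "real poly"
  assumes "\<And>i. i \<ge> n \<Longrightarrow> coeff p i = 0"
  shows "poly p x = (\<Sum>i<n. coeff p i * x ^ i)"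
proof -
  have "(\<Sum>i\<le>degree p. coeff p i * x ^ i) = (\<Sum>i<n. coeff p i * x ^ i)"
    using assms by (intro sum.mono_neutral_cong) (auto simp: not_less not_le coeff_eq_0)
  then show ?thesis by (simp only: poly_altdef)
qed

lemma c_coeff_eq: "(\<Prod>j=1..m. x - lam k j) = (\<Sum>l=0..m. c_coeff k m l * x ^ l)"
proof -
  let ?p = "\<Prod>j=1..m. [:- lam k j, 1:]"
  have "degree ?p \<le> sum (degree \<circ> (\<lambda>j. [:- lam k j, 1:])) {1..m}"
    by (rule degree_prod_sum_le) simp
  then have "degree ?p \<le> m" by simp
  then have "poly ?p x = (\<Sum>l\<le>m. coeff ?p l * x ^ l)"
    unfolding poly_altdef by (intro sum.mono_neutral_left) (auto intro: coeff_eq_0)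
  then show ?thesis
    by (simp add: c_coeff_def poly_prod atLeast0AtMost)
qed

lemma S_coeff_eq:
  assumes "m \<ge> 1"
  shows "poly (P_poly k m) x - poly (P_poly k m) (lam k 1)
    = (x - lam k 1) * (\<Sum>l=1..m-1. S_coeff k m l * x ^ (l - 1))"
proof -
  let ?d = "P_poly k m - [:poly (P_poly k m) (lam k 1):]"
  let ?q = "?d div [:- lam k 1, 1:]"
  have "[:- lam k 1, 1:] dvd ?d"
    by (simp add: poly_eq_0_iff_dvd[symmetric])
  then have fac: "?d = [:- lam k 1, 1:] * ?q"
    by (rule dvd_mult_div_cancel[symmetric])
  have "degree (P_poly k m) \<le> sum (degree \<circ> (\<lambda>j. [:- lam k j, 1:])) {2..m}"
    unfolding P_poly_def by (rule degree_prod_sum_le) simp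
  then have "degree ?d \<le> m - 1"
    by (intro degree_diff_le) simp_all
  moreover have "degree ?d = Suc (degree ?q)" if "?q \<noteq> 0"
    using that by (subst fac, subst degree_mult_eq) simp_all
  ultimately have deg: "coeff ?q i = 0" if "i \<ge> m - 1" for i
    using that by (cases "?q = 0") (simp, rule coeff_eq_0, linarith)
  have "poly ?q x = (\<Sum>i<m-1. coeff ?q i * x ^ i)"
    using deg by (rule poly_eq_sum_lessThan)
  also have "\<dots> = (\<Sum>l=1..m-1. S_coeff k m l * x ^ (l - 1))"
    by (rule sum.reindex_bij_witness[of _ "\<lambda>l. l - 1" Suc]) (auto simp: S_coeff_def)
  finally have "poly ?q x = \<dots>" .
  moreover have "poly ?d x = (x - lam k 1) * poly ?q x"
    by (subst fac) (simp add: algebra_simps)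
  ultimately show ?thesis by simp
qed

end

theory Submission
  imports Defs
begin

text \<open>
  The difference operator and the cyclic shift are circulant, so the vectors \<open>R\<^sub>\<nu>\<close> diagonalise
  both: with \<open>w = \<omega>\<^sup>\<nu>\<close> the eigenvalues are \<open>w - 1\<close> and \<open>cnj w\<close>. Since \<open>\<bar>w - 1\<bar>\<^sup>2 = \<lambda>\<^sub>\<nu>\<close> and
  \<open>cnj w * (w - 1)\<^sup>2 = - \<lambda>\<^sub>\<nu>\<close>, where \<open>\<lambda>\<^sub>\<nu> = 4 sin\<^sup>2 (\<nu>\<pi>/k)\<close>, Parseval turns every norm in the two
  inequalities into a sum \<open>E f = k * (\<Sum>\<nu>. f \<lambda>\<^sub>\<nu> * \<bar>\<zeta>\<^sub>\<nu>\<bar>\<^sup>2)\<close> with a polynomial \<open>f\<close>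
  (\<open>cnorm_cdiff_iterate\<close>, \<open>cnorm_cshift_cdiff\<close>).

  The coefficients are chosen so that both inequalities become the same one. Put
  \<open>Q x = (\<Prod>j=1..m. x - \<lambda>\<^sub>j)\<close>. In the first inequality the left sum is \<open>E Q\<close> and the right sum is
  \<open>E (x Q) / \<lambda>\<^bsub>m+1\<^esub>\<close>, because the \<open>c\<^bsub>m,l\<^esub>\<close> are the coefficients of \<open>Q\<close>. In the second, a term with
  shift contributes \<open>x\<^bsup>l-1\<^esup> (x - \<lambda>\<^sub>1)\<^sup>2\<close>, and the division of \<open>P\<^sub>m\<close> by \<open>x - \<lambda>\<^sub>1\<close> that defines the
  \<open>S\<^bsub>m,l\<^esub>\<close> reassembles the sums to \<open>(x - \<lambda>\<^sub>1) P\<^sub>m = Q\<close> and \<open>x Q\<close> again.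

  Thus \<open>\<lambda>\<^bsub>m+1\<^esub>\<close> times the difference of the two sides is \<open>E (\<Prod>j=1..m+1. x - \<lambda>\<^sub>j)\<close>. The values
  \<open>\<lambda>\<^sub>\<nu>\<close> increase up to \<open>\<nu> = k/2\<close> and are symmetric under \<open>\<nu> \<mapsto> k - \<nu>\<close>, so this product vanishes at
  \<open>\<lambda>\<^sub>\<nu>\<close> if \<open>0 < \<bar>\<nu>\<bar> \<le> m + 1\<close> and is positive at all other nonzero frequencies; the frequency \<open>0\<close>
  is absent because \<open>z\<close> has mean \<open>0\<close>. Both the inequality and its equality case follow
  (\<open>spectral_form_lam_prod\<close>).
\<close>

section \<open>The discrete Fourier transform\<close>

definition unity_root :: "nat \<Rightarrow> complex" where
  "unity_root k = exp (2 * of_real pi * \<i> / of_nat k)"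

lemma unity_root_power: "unity_root k ^ n = cis (2 * (real n * pi / real k))"
proof -
  have "unity_root k = cis (2 * pi / real k)"
    by (simp add: unity_root_def cis_conv_exp mult_ac)
  then show ?thesis
    by (simp add: DeMoivre mult_ac)
qed

lemma unity_root_power_period: "k > 0 \<Longrightarrow> unity_root k ^ k = 1"
  by (simp add: unity_root_power)

lemma unity_root_power_mod: "k > 0 \<Longrightarrow> unity_root k ^ ((n mod k) * \<nu>) = unity_root k ^ (n * \<nu>)"
proof -
  assume k: "k > 0"
  have "unity_root k ^ n = unity_root k ^ (k * (n div k) + n mod k)"
    by simp
  also have "\<dots> = unity_root k ^ (n mod k)"
    unfolding power_add power_mult unity_root_power_period[OF k] by simp
  finally show ?thesis
    by (simp add: power_mult)
qed

lemma unity_root_power_mult_cnj: "unity_root k ^ n * cnj (unity_root k ^ n) = 1"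
  by (simp add: unity_root_power complex_norm_square[symmetric])

text \<open>
  A geometric sum whose ratio is a \<open>k\<close>-th root of unity, equal to \<open>1\<close> only for \<open>i = j\<close>. The sum is
  symmetric in the position and the frequency, so the same lemma serves the inversion formula
  (summing over frequencies) and the coefficients of a trigonometric sum (summing over positions).
\<close>

lemma unity_root_orthogonality:
  assumes "i < k" and "j < k"
  shows "(\<Sum>\<nu><k. unity_root k ^ (i * \<nu>) * cnj (unity_root k ^ (j * \<nu>)))
    = (if i = j then of_nat k else 0)"
proof -
  have k: "k > 0" using assms by simp
  define u where "u = unity_root k ^ i * cnj (unity_root k ^ j)"
  have sum_eq: "(\<Sum>\<nu><k. unity_root k ^ (i * \<nu>) * cnj (unity_root k ^ (j * \<nu>))) = (\<Sum>\<nu><k. u ^ \<nu>)"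
    by (simp add: u_def power_mult power_mult_distrib)
  have "u ^ k = (unity_root k ^ k) ^ i * cnj ((unity_root k ^ k) ^ j)"
    by (simp add: u_def power_mult_distrib power_mult[symmetric] mult.commute)
  then have uk: "u ^ k = 1"
    by (simp add: unity_root_power_period[OF k])
  show ?thesis
  proof (cases "i = j")
    case True
    then have "u = 1" unfolding u_def by (simp only: unity_root_power_mult_cnj)
    then show ?thesis using True sum_eq by simp
  next
    case False
    have "u \<noteq> 1"
    proof
      assume "u = 1"
      then have "unity_root k ^ i * (unity_root k ^ j * cnj (unity_root k ^ j)) = unity_root k ^ j"
        unfolding u_def by (metis mult.assoc mult.commute mult_1)
      then have "unity_root k ^ i = unity_root k ^ j"
        unfolding unity_root_power_mult_cnj by simp
      moreover have "inj_on (\<lambda>n. unity_root k ^ n) {..<k}"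
        using bij_betw_imp_inj_on[OF bij_betw_roots_unity[OF k]]
        by (simp add: unity_root_power mult_ac)
      ultimately show False using False assms by (auto dest: inj_onD)
    qed
    then show ?thesis using False sum_eq uk by (simp add: geometric_sum)
  qed
qed

lemma fourier_vec_altdef: "fourier_vec k \<nu> = vec k (\<lambda>j. unity_root k ^ (j * \<nu>))"
  by (simp add: fourier_vec_def unity_root_def)

lemma fourier_coeff_altdef:
  assumes "z \<in> carrier_vec k"
  shows "fourier_coeff z \<nu> = (\<Sum>j<k. z $ j * cnj (unity_root k ^ (j * \<nu>))) / of_nat k"
  using assms
  by (simp add: fourier_coeff_def scalar_prod_def fourier_vec_altdef atLeast0LessThan)

lemma fourier_inversion:
  assumes z: "z \<in> carrier_vec k" and i: "i < k"
  shows "z $ i = (\<Sum>\<nu><k. fourier_coeff z \<nu> * unity_root k ^ (i * \<nu>))"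
proof -
  have "(\<Sum>\<nu><k. fourier_coeff z \<nu> * unity_root k ^ (i * \<nu>))
    = (\<Sum>\<nu><k. \<Sum>j<k. z $ j * (unity_root k ^ (i * \<nu>) * cnj (unity_root k ^ (j * \<nu>)))) / of_nat k"
    by (simp add: fourier_coeff_altdef[OF z] sum_distrib_right sum_distrib_left sum_divide_distrib mult_ac)
  also have "(\<Sum>\<nu><k. \<Sum>j<k. z $ j * (unity_root k ^ (i * \<nu>) * cnj (unity_root k ^ (j * \<nu>))))
    = (\<Sum>j<k. z $ j * (\<Sum>\<nu><k. unity_root k ^ (i * \<nu>) * cnj (unity_root k ^ (j * \<nu>))))"
    by (subst sum.swap) (simp add: sum_distrib_left)
  also have "\<dots> = (\<Sum>j<k. if i = j then z $ j * of_nat k else 0)"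
    by (rule sum.cong) (use i in \<open>simp_all add: unity_root_orthogonality del: complex_cnj_power\<close>)
  also have "\<dots> = z $ i * of_nat k"
    using i by simp
  finally show ?thesis using i by simp
qed

lemma parseval:
  assumes z: "z \<in> carrier_vec k" and "k > 0"
  shows "(cnorm z)\<^sup>2 = real k * (\<Sum>\<nu><k. (cmod (fourier_coeff z \<nu>))\<^sup>2)"
proof -
  have "z \<bullet>c z = (\<Sum>i<k. z $ i * cnj (\<Sum>\<nu><k. fourier_coeff z \<nu> * unity_root k ^ (i * \<nu>)))"
    using z fourier_inversion[OF z] by (simp add: scalar_prod_def atLeast0LessThan)
  also have "\<dots> = (\<Sum>\<nu><k. cnj (fourier_coeff z \<nu>) * (\<Sum>i<k. z $ i * cnj (unity_root k ^ (i * \<nu>))))"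
    unfolding cnj_sum sum_distrib_left by (subst sum.swap) (simp add: mult_ac)
  also have "\<dots> = of_real (real k * (\<Sum>\<nu><k. (cmod (fourier_coeff z \<nu>))\<^sup>2))"
  proof -
    have "(\<Sum>i<k. z $ i * cnj (unity_root k ^ (i * \<nu>))) = of_nat k * fourier_coeff z \<nu>" for \<nu>
      using \<open>k > 0\<close> by (simp add: fourier_coeff_altdef[OF z])
    then show ?thesis
      by (simp add: sum_distrib_left complex_norm_square[symmetric] mult_ac
          del: complex_cnj_power of_real_power)
  qed
  finally have "Re (z \<bullet>c z) = real k * (\<Sum>\<nu><k. (cmod (fourier_coeff z \<nu>))\<^sup>2)"
    by (simp only: Re_complex_of_real)
  moreover from this have "Re (z \<bullet>c z) \<ge> 0"
    by (simp add: sum_nonneg)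
  ultimately show ?thesis
    by (simp add: cnorm_def)
qed

lemma fourier_coeff_linear_combination:
  assumes A: "A \<subseteq> {..<k}" and "\<nu> < k"
  shows "fourier_coeff (finsum_vec TYPE(complex) k (\<lambda>\<mu>. a \<mu> \<cdot>\<^sub>v fourier_vec k \<mu>) A) \<nu>
    = (if \<nu> \<in> A then a \<nu> else 0)"
proof -
  have fin: "finite A" using A finite_subset by blast
  have vecs: "(\<lambda>\<mu>. a \<mu> \<cdot>\<^sub>v fourier_vec k \<mu>) \<in> A \<rightarrow> carrier_vec k"
    by (simp add: fourier_vec_def)
  let ?s = "finsum_vec TYPE(complex) k (\<lambda>\<mu>. a \<mu> \<cdot>\<^sub>v fourier_vec k \<mu>) A"
  have s: "?s \<in> carrier_vec k"
    using vecs by (rule finsum_vec_closed)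
  have "(\<Sum>j<k. ?s $ j * cnj (unity_root k ^ (j * \<nu>)))
    = (\<Sum>j<k. \<Sum>\<mu>\<in>A. a \<mu> * (unity_root k ^ (\<mu> * j) * cnj (unity_root k ^ (\<nu> * j))))"
    by (intro sum.cong refl, subst index_finsum_vec[OF fin _ vecs])
      (simp_all add: fourier_vec_altdef sum_distrib_left mult_ac)
  also have "\<dots> = (\<Sum>\<mu>\<in>A. a \<mu> * (\<Sum>j<k. unity_root k ^ (\<mu> * j) * cnj (unity_root k ^ (\<nu> * j))))"
    by (subst sum.swap) (simp add: sum_distrib_left)
  also have "\<dots> = (\<Sum>\<mu>\<in>A. if \<nu> = \<mu> then a \<mu> * of_nat k else 0)"
  proof (rule sum.cong[OF refl])
    fix \<mu> assume "\<mu> \<in> A"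
    then have "\<mu> < k" using A by auto
    from unity_root_orthogonality[OF this \<open>\<nu> < k\<close>]
    show "a \<mu> * (\<Sum>j<k. unity_root k ^ (\<mu> * j) * cnj (unity_root k ^ (\<nu> * j)))
        = (if \<nu> = \<mu> then a \<mu> * of_nat k else 0)"
      by (simp del: complex_cnj_power)
  qed
  also have "\<dots> = (if \<nu> \<in> A then a \<nu> * of_nat k else 0)"
    using fin by simp
  finally show ?thesis
    using \<open>\<nu> < k\<close> by (simp add: fourier_coeff_altdef[OF s] del: complex_cnj_power)
qed

text \<open>
  By uniqueness of Fourier coefficients, a vector is the partial sum of its Fourier series over \<open>A\<close>
  exactly if it has no frequencies outside \<open>A\<close>. This is how the equality case becomes a condition
  on single coefficients.
\<close>

lemma fourier_synthesis_iff:
  assumes z: "z \<in> carrier_vec k" and A: "A \<subseteq> {..<k}"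
  shows "z = finsum_vec TYPE(complex) k (\<lambda>\<nu>. fourier_coeff z \<nu> \<cdot>\<^sub>v fourier_vec k \<nu>) A
    \<longleftrightarrow> (\<forall>\<nu><k. \<nu> \<notin> A \<longrightarrow> fourier_coeff z \<nu> = 0)" (is "z = ?s \<longleftrightarrow> ?R")
proof
  assume eq: "z = ?s"
  show ?R
  proof (intro allI impI)
    fix \<nu> assume "\<nu> < k" "\<nu> \<notin> A"
    have "fourier_coeff z \<nu> = fourier_coeff ?s \<nu>" using eq by simp
    then show "fourier_coeff z \<nu> = 0"
      using fourier_coeff_linear_combination[OF A \<open>\<nu> < k\<close>] \<open>\<nu> \<notin> A\<close> by simp
  qed
next
  assume R: ?R
  have fin: "finite A" using A finite_subset by blast
  have vecs: "(\<lambda>\<mu>. fourier_coeff z \<mu> \<cdot>\<^sub>v fourier_vec k \<mu>) \<in> A \<rightarrow> carrier_vec k"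
    by (simp add: fourier_vec_def)
  have s: "?s \<in> carrier_vec k"
    using vecs by (rule finsum_vec_closed)
  show "z = ?s"
  proof (rule eq_vecI)
    fix i assume "i < dim_vec ?s"
    then have i: "i < k" using s by simp
    have "?s $ i = (\<Sum>\<nu>\<in>A. fourier_coeff z \<nu> * unity_root k ^ (i * \<nu>))"
      by (subst index_finsum_vec[OF fin i vecs]) (use i in \<open>simp add: fourier_vec_altdef\<close>)
    also have "\<dots> = (\<Sum>\<nu><k. fourier_coeff z \<nu> * unity_root k ^ (i * \<nu>))"
      by (rule sum.mono_neutral_left) (use A R in auto)
    finally show "z $ i = ?s $ i"
      using fourier_inversion[OF z i] by simp
  qed (use s z in simp)
qed

section \<open>Differences and shifts on the Fourier side\<close>

text \<open>
  The index set is permuted by the translation modulo \<open>k\<close>, and the powers of \<open>\<omega>\<close> do not see the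
  reduction modulo \<open>k\<close>. With \<open>s = 1\<close> this gives the difference operator, and with \<open>s = k - 1\<close> the
  cyclic shift.
\<close>

lemma fourier_coeff_translate:
  assumes z: "z \<in> carrier_vec k" and "k > 0"
  shows "fourier_coeff (vec k (\<lambda>i. z $ ((i + s) mod k))) \<nu> = unity_root k ^ (s * \<nu>) * fourier_coeff z \<nu>"
proof -
  have bij: "bij_betw (\<lambda>i. (i + s) mod k) {..<k} {..<k}"
  proof -
    have "inj_on (\<lambda>i. (i + s) mod k) {..<k}"
    proof (rule inj_onI)
      fix i j assume "i \<in> {..<k}" "j \<in> {..<k}" "(i + s) mod k = (j + s) mod k"
      then have "\<exists>p q. i + k * p = j + k * q"
        by (auto simp: nat_mod_eq_iff)
      then have "i mod k = j mod k"
        by (simp only: nat_mod_eq_iff)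
      then show "i = j"
        using \<open>i \<in> {..<k}\<close> \<open>j \<in> {..<k}\<close> by simp
    qed
    moreover have "(\<lambda>i. (i + s) mod k) ` {..<k} \<subseteq> {..<k}"
      using \<open>k > 0\<close> by auto
    ultimately show ?thesis
      by (simp add: bij_betw_def endo_inj_surj)
  qed
  let ?w = "unity_root k"
  have "(\<Sum>j<k. z $ j * cnj (?w ^ (j * \<nu>)))
    = (\<Sum>i<k. z $ ((i + s) mod k) * cnj (?w ^ (((i + s) mod k) * \<nu>)))"
    by (rule sum.reindex_bij_betw[OF bij, symmetric])
  also have "\<dots> = (\<Sum>i<k. z $ ((i + s) mod k) * cnj (?w ^ (i * \<nu>))) * cnj (?w ^ (s * \<nu>))"
    unfolding unity_root_power_mod[OF \<open>k > 0\<close>]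
    by (simp add: distrib_left power_add sum_distrib_left mult_ac)
  finally have "?w ^ (s * \<nu>) * (\<Sum>j<k. z $ j * cnj (?w ^ (j * \<nu>)))
    = (\<Sum>i<k. z $ ((i + s) mod k) * cnj (?w ^ (i * \<nu>))) * (?w ^ (s * \<nu>) * cnj (?w ^ (s * \<nu>)))"
    by (simp only: mult_ac)
  then show ?thesis
    unfolding unity_root_power_mult_cnj
    by (simp add: fourier_coeff_altdef[OF z] fourier_coeff_altdef[of _ k])
qed

lemma fourier_coeff_add:
  assumes "u \<in> carrier_vec k" and "v \<in> carrier_vec k"
  shows "fourier_coeff (u + v) \<nu> = fourier_coeff u \<nu> + fourier_coeff v \<nu>"
  using assms
  by (simp add: fourier_coeff_altdef[of _ k] distrib_right sum.distrib add_divide_distrib)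

lemma fourier_coeff_smult:
  assumes "u \<in> carrier_vec k"
  shows "fourier_coeff (a \<cdot>\<^sub>v u) \<nu> = a * fourier_coeff u \<nu>"
  using assms
  by (simp add: fourier_coeff_altdef[of _ k] sum_distrib_left mult_ac)

lemma cdiff_carrier [simp]: "z \<in> carrier_vec k \<Longrightarrow> cdiff z \<in> carrier_vec k"
  by (simp add: cdiff_def)

lemma cshift_carrier [simp]: "z \<in> carrier_vec k \<Longrightarrow> cshift z \<in> carrier_vec k"
  by (simp add: cshift_def)

lemma cdiff_iterate_carrier [simp]: "z \<in> carrier_vec k \<Longrightarrow> (cdiff ^^ l) z \<in> carrier_vec k"
  by (induction l) simp_all

lemma fourier_coeff_cdiff:
  assumes z: "z \<in> carrier_vec k" and "k > 0"
  shows "fourier_coeff (cdiff z) \<nu> = (unity_root k ^ \<nu> - 1) * fourier_coeff z \<nu>"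
proof -
  have "cdiff z = vec k (\<lambda>i. z $ ((i + 1) mod k)) + (-1) \<cdot>\<^sub>v z"
    using z by (intro eq_vecI) (simp_all add: cdiff_def)
  then show ?thesis
    using fourier_coeff_translate[OF assms, of 1 \<nu>] z
    by (simp add: fourier_coeff_add[of _ k] fourier_coeff_smult[of _ k] left_diff_distrib
        del: One_nat_def)
qed

lemma fourier_coeff_cdiff_iterate:
  assumes z: "z \<in> carrier_vec k" and "k > 0"
  shows "fourier_coeff ((cdiff ^^ l) z) \<nu> = (unity_root k ^ \<nu> - 1) ^ l * fourier_coeff z \<nu>"
  using assms by (induction l) (simp_all add: fourier_coeff_cdiff[of _ k])

lemma fourier_coeff_cshift:
  assumes z: "z \<in> carrier_vec k" and "k > 0"
  shows "fourier_coeff (cshift z) \<nu> = cnj (unity_root k ^ \<nu>) * fourier_coeff z \<nu>"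
proof -
  have "cshift z = vec k (\<lambda>i. z $ ((i + (k - 1)) mod k))"
    using z \<open>k > 0\<close> by (simp add: cshift_def)
  moreover have "unity_root k ^ ((k - 1) * \<nu>) = cnj (unity_root k ^ \<nu>)"
  proof -
    have "(k - 1) * \<nu> + \<nu> = k * \<nu>"
      using \<open>k > 0\<close> by (cases k) simp_all
    then have "unity_root k ^ ((k - 1) * \<nu>) * unity_root k ^ \<nu> = 1"
      unfolding power_add[symmetric] by (simp add: power_mult unity_root_power_period[OF \<open>k > 0\<close>])
    then have "unity_root k ^ ((k - 1) * \<nu>) * (unity_root k ^ \<nu> * cnj (unity_root k ^ \<nu>))
      = cnj (unity_root k ^ \<nu>)"
      by (simp add: mult.assoc[symmetric])
    then show ?thesis
      unfolding unity_root_power_mult_cnj by simp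
  qed
  ultimately show ?thesis
    using fourier_coeff_translate[OF assms, of "k - 1" \<nu>] by simp
qed

lemma unity_root_diff_norm: "(cmod (unity_root k ^ \<nu> - 1))\<^sup>2 = lam k \<nu>"
proof -
  define t where "t = real \<nu> * pi / real k"
  have "(cmod (cis (2 * t) - 1))\<^sup>2 = (cos (2 * t) - 1)\<^sup>2 + (sin (2 * t))\<^sup>2"
    by (simp add: cmod_power2)
  also have "\<dots> = 2 - 2 * cos (2 * t)"
    using sin_cos_squared_add[of "2 * t"] by (simp add: power2_eq_square algebra_simps)
  also have "\<dots> = 4 * (sin t)\<^sup>2"
    by (simp add: cos_double_sin)
  finally show ?thesis
    by (simp add: unity_root_power lam_def t_def)
qed

text \<open>
  As \<open>cnj w\<close> is the inverse of \<open>w = \<omega>\<^sup>\<nu>\<close>, one has \<open>cnj w * (w - 1) = - cnj (w - 1)\<close>. Hence the shift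
  turns the second difference into a real operator, with eigenvalue \<open>- \<lambda>\<^sub>\<nu>\<close>.
\<close>

lemma cnj_unity_root_diff_square:
  "cnj (unity_root k ^ \<nu>) * (unity_root k ^ \<nu> - 1)\<^sup>2 = - of_real (lam k \<nu>)"
proof -
  let ?w = "unity_root k ^ \<nu>"
  have "cnj ?w * (?w - 1)\<^sup>2 = (?w * cnj ?w - cnj ?w) * (?w - 1)"
    by (simp add: power2_eq_square algebra_simps)
  also have "\<dots> = - ((?w - 1) * cnj (?w - 1))"
    unfolding unity_root_power_mult_cnj by (simp add: algebra_simps)
  also have "\<dots> = - of_real (lam k \<nu>)"
    by (simp only: complex_norm_square[symmetric] unity_root_diff_norm of_real_power[symmetric])
  finally show ?thesis .
qed

text \<open>
  The Hermitian form of \<open>f L\<close> at \<open>z\<close>, where \<open>L\<close> is the negative of the centred cyclic second difference; the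
  \<open>\<lambda>\<^sub>\<nu>\<close> are the eigenvalues of \<open>L\<close>.
\<close>

definition spectral_form :: "complex vec \<Rightarrow> (real \<Rightarrow> real) \<Rightarrow> real" where
  "spectral_form z f = real (dim_vec z) *
    (\<Sum>\<nu><dim_vec z. f (lam (dim_vec z) \<nu>) * (cmod (fourier_coeff z \<nu>))\<^sup>2)"

lemma spectral_form_add: "spectral_form z (\<lambda>x. f x + g x) = spectral_form z f + spectral_form z g"
  by (simp add: spectral_form_def distrib_right sum.distrib distrib_left)

lemma spectral_form_diff: "spectral_form z (\<lambda>x. f x - g x) = spectral_form z f - spectral_form z g"
  by (simp add: spectral_form_def left_diff_distrib sum_subtractf right_diff_distrib)

lemma spectral_form_scale: "spectral_form z (\<lambda>x. a * f x) = a * spectral_form z f"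
  by (simp add: spectral_form_def sum_distrib_left mult_ac)

lemma spectral_form_zero: "spectral_form z (\<lambda>x. 0) = 0"
  by (simp add: spectral_form_def)

lemma spectral_form_sum: "spectral_form z (\<lambda>x. \<Sum>l\<in>A. f l x) = (\<Sum>l\<in>A. spectral_form z (f l))"
  by (induction A rule: infinite_finite_induct) (simp_all add: spectral_form_zero spectral_form_add)

lemma cnorm_square_spectral:
  assumes "w \<in> carrier_vec k" and "z \<in> carrier_vec k" and "k > 0"
    and "\<And>\<nu>. (cmod (fourier_coeff w \<nu>))\<^sup>2 = f (lam k \<nu>) * (cmod (fourier_coeff z \<nu>))\<^sup>2"
  shows "(cnorm w)\<^sup>2 = spectral_form z f"
  using assms by (simp add: parseval[of w k] spectral_form_def)

lemma cnorm_cdiff_iterate: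
  assumes "z \<in> carrier_vec k" and "k > 0"
  shows "(cnorm ((cdiff ^^ l) z))\<^sup>2 = spectral_form z (\<lambda>x. x ^ l)"
proof (rule cnorm_square_spectral[OF _ assms])
  fix \<nu>
  have "(cmod (fourier_coeff ((cdiff ^^ l) z) \<nu>))\<^sup>2
    = ((cmod (unity_root k ^ \<nu> - 1))\<^sup>2) ^ l * (cmod (fourier_coeff z \<nu>))\<^sup>2"
    unfolding fourier_coeff_cdiff_iterate[OF assms] norm_mult norm_power power_mult_distrib
    by (simp only: power_mult[symmetric] mult.commute)
  then show "(cmod (fourier_coeff ((cdiff ^^ l) z) \<nu>))\<^sup>2 = lam k \<nu> ^ l * (cmod (fourier_coeff z \<nu>))\<^sup>2"
    by (simp only: unity_root_diff_norm)
qed (use assms in simp)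

lemma cnorm_cdiff_minus:
  assumes "z \<in> carrier_vec k" and "k > 0"
  shows "(cnorm (cdiff z))\<^sup>2 - a * (cnorm z)\<^sup>2 = spectral_form z (\<lambda>x. x - a)"
  using cnorm_cdiff_iterate[OF assms, of 1] cnorm_cdiff_iterate[OF assms, of 0]
  by (simp add: spectral_form_diff spectral_form_scale[of z a "\<lambda>x. 1", simplified])

text \<open>
  On the Fourier side the vector is \<open>(w - 1)\<^sup>l (a - \<lambda>\<^sub>\<nu>) \<zeta>\<^sub>\<nu>\<close>: the shift makes the factor
  \<open>(w - 1)\<^sup>2\<close> real, so that it combines with \<open>a\<close> to a linear factor in \<open>\<lambda>\<^sub>\<nu>\<close>.
\<close>

lemma cnorm_cshift_cdiff:
  assumes "z \<in> carrier_vec k" and "k > 0"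
  shows "(cnorm (cshift ((cdiff ^^ (l + 2)) z) + complex_of_real a \<cdot>\<^sub>v (cdiff ^^ l) z))\<^sup>2
    = spectral_form z (\<lambda>x. x ^ l * (x - a)\<^sup>2)"
proof (rule cnorm_square_spectral[OF _ assms])
  fix \<nu>
  let ?w = "unity_root k ^ \<nu>"
  let ?v = "cshift ((cdiff ^^ (l + 2)) z) + complex_of_real a \<cdot>\<^sub>v (cdiff ^^ l) z"
  have "fourier_coeff ?v \<nu> = cnj ?w * ((?w - 1) ^ (l + 2) * fourier_coeff z \<nu>)
      + of_real a * ((?w - 1) ^ l * fourier_coeff z \<nu>)"
    using assms
    by (simp only: fourier_coeff_add[of _ k] fourier_coeff_smult[of _ k] fourier_coeff_cshift[of _ k]
        fourier_coeff_cdiff_iterate[of _ k] cshift_carrier cdiff_iterate_carrier smult_carrier_vec)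
  also have "\<dots> = (cnj ?w * (?w - 1)\<^sup>2 + of_real a) * (?w - 1) ^ l * fourier_coeff z \<nu>"
    by (simp only: power_add algebra_simps)
  also have "\<dots> = of_real (a - lam k \<nu>) * (?w - 1) ^ l * fourier_coeff z \<nu>"
    by (simp add: cnj_unity_root_diff_square del: complex_cnj_power)
  finally have "(cmod (fourier_coeff ?v \<nu>))\<^sup>2
      = (a - lam k \<nu>)\<^sup>2 * ((cmod (?w - 1))\<^sup>2) ^ l * (cmod (fourier_coeff z \<nu>))\<^sup>2"
    by (simp only: norm_mult norm_power norm_of_real power_mult_distrib power2_abs power_mult[symmetric]
        mult.commute[of l 2])
  then show "(cmod (fourier_coeff ?v \<nu>))\<^sup>2 = lam k \<nu> ^ l * (lam k \<nu> - a)\<^sup>2 * (cmod (fourier_coeff z \<nu>))\<^sup>2"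
    by (simp add: unity_root_diff_norm power2_commute mult_ac)
qed (use assms in simp)

section \<open>The eigenvalues and the sign of their polynomial\<close>

lemma lam_reflect: "\<nu> \<le> k \<Longrightarrow> k > 0 \<Longrightarrow> lam k (k - \<nu>) = lam k \<nu>"
proof -
  assume "\<nu> \<le> k" "k > 0"
  then have "real (k - \<nu>) * pi / real k = pi - real \<nu> * pi / real k"
    by (simp add: of_nat_diff field_simps)
  then show ?thesis by (simp add: lam_def)
qed

lemma lam_strict_mono:
  assumes "i < j" and "2 * j \<le> k"
  shows "lam k i < lam k j"
proof -
  have k: "real k > 0" using assms by simp
  have le: "real j * pi / real k \<le> pi / 2"
  proof -
    have "real (2 * j) \<le> real k" using assms by (simp only: of_nat_le_iff)
    then show ?thesis using k by (simp add: field_simps)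
  qed
  have less: "real i * pi / real k < real j * pi / real k"
    using assms k by (simp add: divide_strict_right_mono)
  have "- (pi / 2) \<le> real i * pi / real k"
    by (rule order_trans[of _ 0]) simp_all
  then have "sin (real i * pi / real k) < sin (real j * pi / real k)"
    using less le by (rule sin_monotone_2pi)
  moreover have "0 \<le> sin (real i * pi / real k)"
  proof (rule sin_ge_zero)
    show "real i * pi / real k \<le> pi" using less le pi_gt_zero by linarith
  qed simp
  ultimately show ?thesis
    by (simp add: lam_def power_strict_mono)
qed

lemma lam_prod_low:
  assumes "\<nu> \<in> low_freqs k n" and "n < k"
  shows "(\<Prod>j=1..n. lam k \<nu> - lam k j) = 0"
proof -
  have "\<exists>j\<in>{1..n}. lam k \<nu> = lam k j"
  proof (cases "\<nu> \<in> {1..n}")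
    case False
    then have "k - \<nu> \<in> {1..n}" "\<nu> \<le> k" "k > 0"
      using assms by (auto simp: low_freqs_def)
    then show ?thesis using lam_reflect[of \<nu> k] by metis
  qed auto
  then show ?thesis by auto
qed

text \<open>
  Up to the reflection \<open>\<nu> \<mapsto> k - \<nu>\<close> the frequency lies between \<open>n + 1\<close> and \<open>k/2\<close>, where
  \<open>\<lambda>\<close> is strictly increasing; so every factor is positive.
\<close>

lemma lam_prod_high:
  assumes "0 < \<nu>" and "\<nu> < k" and "\<nu> \<notin> low_freqs k n"
  shows "(\<Prod>j=1..n. lam k \<nu> - lam k j) > 0"
proof -
  define \<mu> where "\<mu> = min \<nu> (k - \<nu>)"
  have \<mu>: "n < \<mu>" "2 * \<mu> \<le> k" "lam k \<nu> = lam k \<mu>"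
    using assms lam_reflect[of \<nu> k] by (auto simp: low_freqs_def \<mu>_def min_def)
  show ?thesis
    by (rule prod_pos) (use \<mu> lam_strict_mono in auto)
qed

section \<open>The inequalities\<close>

lemma fourier_coeff_0:
  assumes "z \<in> carrier_vec k"
  shows "fourier_coeff z 0 = (\<Sum>\<nu><k. z $ \<nu>) / of_nat k"
  by (simp add: fourier_coeff_altdef[OF assms])

text \<open>
  Every summand of the form is nonnegative: frequency \<open>0\<close> drops out by the mean condition, low
  frequencies are roots of the product, and at high frequencies the product is positive. The last
  case is the only one that forces a coefficient to vanish when the form does.
\<close>

lemma spectral_form_lam_prod:
  assumes z: "z \<in> carrier_vec k" and "n < k" and mean: "fourier_coeff z 0 = 0"
  defines "E \<equiv> spectral_form z (\<lambda>x. \<Prod>j=1..n. x - lam k j)"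
  shows "E \<ge> 0"
    and "E = 0 \<longleftrightarrow> (\<forall>\<nu><k. \<nu> \<notin> low_freqs k n \<longrightarrow> fourier_coeff z \<nu> = 0)"
proof -
  let ?f = "\<lambda>\<nu>. (\<Prod>j=1..n. lam k \<nu> - lam k j) * (cmod (fourier_coeff z \<nu>))\<^sup>2"
  have E: "E = real k * (\<Sum>\<nu><k. ?f \<nu>)"
    using z by (simp add: E_def spectral_form_def)
  have nonneg: "?f \<nu> \<ge> 0" and zero: "?f \<nu> = 0 \<longleftrightarrow> (\<nu> \<notin> low_freqs k n \<longrightarrow> fourier_coeff z \<nu> = 0)"
    if "\<nu> < k" for \<nu>
  proof -
    consider "\<nu> = 0" | "\<nu> \<in> low_freqs k n" | "0 < \<nu>" "\<nu> \<notin> low_freqs k n" by blast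
    then have "?f \<nu> \<ge> 0 \<and> (?f \<nu> = 0 \<longleftrightarrow> (\<nu> \<notin> low_freqs k n \<longrightarrow> fourier_coeff z \<nu> = 0))"
    proof cases
      case 1
      then show ?thesis using mean by simp
    next
      case 2
      then show ?thesis using lam_prod_low[OF 2 \<open>n < k\<close>] by (simp del: prod_zero_iff)
    next
      case 3
      then have "(\<Prod>j=1..n. lam k \<nu> - lam k j) > 0"
        using \<open>\<nu> < k\<close> lam_prod_high by blast
      then show ?thesis using 3 by (simp del: prod_zero_iff)
    qed
    then show "?f \<nu> \<ge> 0" "?f \<nu> = 0 \<longleftrightarrow> (\<nu> \<notin> low_freqs k n \<longrightarrow> fourier_coeff z \<nu> = 0)"
      by blast+
  qed
  show "E \<ge> 0"
    unfolding E by (intro mult_nonneg_nonneg sum_nonneg nonneg) simp_all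
  have "E = 0 \<longleftrightarrow> (\<Sum>\<nu><k. ?f \<nu>) = 0"
    unfolding E using \<open>n < k\<close> by simp
  also have "\<dots> \<longleftrightarrow> (\<forall>\<nu>\<in>{..<k}. ?f \<nu> = 0)"
    by (rule sum_nonneg_eq_0_iff) (use nonneg in auto)
  also have "\<dots> \<longleftrightarrow> (\<forall>\<nu><k. \<nu> \<notin> low_freqs k n \<longrightarrow> fourier_coeff z \<nu> = 0)"
    using zero by (simp only: Ball_def lessThan_iff) blast
  finally show "E = 0 \<longleftrightarrow> (\<forall>\<nu><k. \<nu> \<notin> low_freqs k n \<longrightarrow> fourier_coeff z \<nu> = 0)" .
qed

lemma P_poly_lam_prod:
  assumes "m \<ge> 1"
  shows "(x - lam k 1) * poly (P_poly k m) x = (\<Prod>j=1..m. x - lam k j)"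
  unfolding prod.atLeast_Suc_atMost[OF assms]
  by (simp add: P_poly_def poly_prod numeral_2_eq_2)

lemma c_coeff_sum_spectral:
  assumes "z \<in> carrier_vec k" and "k > 0"
  shows "(\<Sum>l=0..m. c_coeff k m l * (cnorm ((cdiff ^^ (l + n)) z))\<^sup>2)
    = spectral_form z (\<lambda>x. x ^ n * (\<Prod>j=1..m. x - lam k j))"
  unfolding cnorm_cdiff_iterate[OF assms] c_coeff_eq sum_distrib_left
  by (simp add: spectral_form_sum spectral_form_scale[symmetric] power_add mult_ac)

text \<open>
  The leading term contributes \<open>S\<^bsub>m,0\<^esub> (x - \<lambda>\<^sub>1)\<close> and the sum contributes
  \<open>(x - \<lambda>\<^sub>1) (P\<^sub>m - S\<^bsub>m,0\<^esub>)\<close>, by the division that defines the \<open>S\<^bsub>m,l\<^esub>\<close>. Together they give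
  \<open>(x - \<lambda>\<^sub>1) P\<^sub>m\<close>.
\<close>

lemma S_coeff_sum_spectral:
  assumes z: "z \<in> carrier_vec k" and k: "k > 0" and m: "m \<ge> 1"
  shows "S_coeff k m 0 * ((cnorm (cdiff z))\<^sup>2 - lam k 1 * (cnorm z)\<^sup>2)
           + (\<Sum>l=1..m-1. S_coeff k m l *
               (cnorm (cshift ((cdiff ^^ (l + 1)) z)
                 + complex_of_real (lam k 1) \<cdot>\<^sub>v (cdiff ^^ (l - 1)) z))\<^sup>2)
    = spectral_form z (\<lambda>x. \<Prod>j=1..m. x - lam k j)"
proof -
  let ?a = "lam k 1"
  note base = cnorm_cdiff_minus[OF z k, of ?a]
  have "(cnorm (cshift ((cdiff ^^ (l + 1)) z) + complex_of_real ?a \<cdot>\<^sub>v (cdiff ^^ (l - 1)) z))\<^sup>2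
    = spectral_form z (\<lambda>x. x ^ (l - 1) * (x - ?a)\<^sup>2)" if "l \<in> {1..m-1}" for l
  proof -
    \<comment> \<open>matches the exponents with the pattern \<open>l + 2\<close>, \<open>l\<close> of the norm formula\<close>
    have "l + 1 = (l - 1) + 2" using that by simp
    then show ?thesis by (simp only: cnorm_cshift_cdiff[OF z k])
  qed
  then have "?thesis \<longleftrightarrow> S_coeff k m 0 * spectral_form z (\<lambda>x. x - ?a)
      + (\<Sum>l=1..m-1. S_coeff k m l * spectral_form z (\<lambda>x. x ^ (l - 1) * (x - ?a)\<^sup>2))
    = spectral_form z (\<lambda>x. \<Prod>j=1..m. x - lam k j)"
    unfolding base by simp
  moreover have "S_coeff k m 0 * (x - ?a) + (\<Sum>l=1..m-1. S_coeff k m l * (x ^ (l - 1) * (x - ?a)\<^sup>2))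
    = (\<Prod>j=1..m. x - lam k j)" for x
  proof -
    have "(\<Sum>l=1..m-1. S_coeff k m l * (x ^ (l - 1) * (x - ?a)\<^sup>2))
      = (x - ?a) * ((x - ?a) * (\<Sum>l=1..m-1. S_coeff k m l * x ^ (l - 1)))"
      by (simp add: sum_distrib_left power2_eq_square mult_ac)
    also have "\<dots> = (x - ?a) * (poly (P_poly k m) x - S_coeff k m 0)"
      unfolding S_coeff_eq[OF m, symmetric] by (simp add: S_coeff_def)
    finally show ?thesis
      unfolding P_poly_lam_prod[OF m, symmetric] by (simp add: algebra_simps)
  qed
  ultimately show ?thesis
    by (simp only: spectral_form_scale[symmetric] spectral_form_sum[symmetric] spectral_form_add[symmetric])
qed

text \<open>
  Here the term \<open>l = 0\<close> of the sum contributes \<open>S\<^bsub>m,0\<^esub> (x - \<lambda>\<^sub>1)\<^sup>2\<close>, which the separate term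
  \<open>\<lambda>\<^sub>1 S\<^bsub>m,0\<^esub> (x - \<lambda>\<^sub>1)\<close> completes to \<open>x S\<^bsub>m,0\<^esub> (x - \<lambda>\<^sub>1)\<close>. The remaining terms are \<open>x\<close> times those with
  factor \<open>x\<^bsup>l-1\<^esup> (x - \<lambda>\<^sub>1)\<^sup>2\<close>, and the total is \<open>x (x - \<lambda>\<^sub>1) P\<^sub>m\<close>.
\<close>

lemma S_coeff_sum_spectral_step:
  assumes z: "z \<in> carrier_vec k" and k: "k > 0" and m: "m \<ge> 1"
  shows "lam k 1 * S_coeff k m 0 * ((cnorm (cdiff z))\<^sup>2 - lam k 1 * (cnorm z)\<^sup>2)
            + (\<Sum>l=0..m-1. S_coeff k m l *
                (cnorm (cshift ((cdiff ^^ (l + 2)) z)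
                  + complex_of_real (lam k 1) \<cdot>\<^sub>v (cdiff ^^ l) z))\<^sup>2)
    = spectral_form z (\<lambda>x. x * (\<Prod>j=1..m. x - lam k j))"
proof -
  let ?a = "lam k 1"
  note base = cnorm_cdiff_minus[OF z k, of ?a]
  have "?a * S_coeff k m 0 * (x - ?a) + (\<Sum>l=0..m-1. S_coeff k m l * (x ^ l * (x - ?a)\<^sup>2))
    = x * (\<Prod>j=1..m. x - lam k j)" for x
  proof -
    have "(\<Sum>l=0..m-1. S_coeff k m l * (x ^ l * (x - ?a)\<^sup>2))
      = S_coeff k m 0 * (x - ?a)\<^sup>2 + (\<Sum>l=1..m-1. S_coeff k m l * (x ^ l * (x - ?a)\<^sup>2))"
      by (simp add: sum.atLeast_Suc_atMost)
    also have "(\<Sum>l=1..m-1. S_coeff k m l * (x ^ l * (x - ?a)\<^sup>2))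
      = (\<Sum>l=1..m-1. x * (x - ?a) * ((x - ?a) * (S_coeff k m l * x ^ (l - 1))))"
    proof (rule sum.cong[OF refl])
      fix l assume "l \<in> {1..m-1}"
      then have "x ^ l = x * x ^ (l - 1)" by (cases l) simp_all
      then show "S_coeff k m l * (x ^ l * (x - ?a)\<^sup>2) = x * (x - ?a) * ((x - ?a) * (S_coeff k m l * x ^ (l - 1)))"
        by (simp only: power2_eq_square mult_ac)
    qed
    also have "\<dots> = x * (x - ?a) * ((x - ?a) * (\<Sum>l=1..m-1. S_coeff k m l * x ^ (l - 1)))"
      by (simp only: sum_distrib_left)
    also have "\<dots> = x * (x - ?a) * (poly (P_poly k m) x - S_coeff k m 0)"
      unfolding S_coeff_eq[OF m, symmetric] by (simp add: S_coeff_def)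
    finally show ?thesis
      unfolding P_poly_lam_prod[OF m, symmetric] by (simp add: algebra_simps power2_eq_square)
  qed
  then show ?thesis
    unfolding base cnorm_cshift_cdiff[OF z k]
    by (simp only: spectral_form_scale[symmetric] spectral_form_sum[symmetric] spectral_form_add[symmetric])
qed

theorem proposition4:
  fixes k m :: nat and z :: "complex vec"
  assumes "1 \<le> m" and "m \<le> k div 2 - 1"
    and "z \<in> carrier_vec k"
    and "(\<Sum>\<nu><k. z $ \<nu>) = 0"
  shows
    "let lhs1 = (\<Sum>l=0..m. c_coeff k m l * (cnorm ((cdiff ^^ l) z))\<^sup>2);
         rhs1 = 1 / lam k (m + 1) *
           (\<Sum>l=0..m. c_coeff k m l * (cnorm ((cdiff ^^ (l + 1)) z))\<^sup>2);
         lhs2 = S_coeff k m 0 * ((cnorm (cdiff z))\<^sup>2 - lam k 1 * (cnorm z)\<^sup>2)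
           + (\<Sum>l=1..m-1. S_coeff k m l *
               (cnorm (cshift ((cdiff ^^ (l + 1)) z)
                 + complex_of_real (lam k 1) \<cdot>\<^sub>v (cdiff ^^ (l - 1)) z))\<^sup>2);
         rhs2 = 1 / lam k (m + 1) *
           (lam k 1 * S_coeff k m 0 * ((cnorm (cdiff z))\<^sup>2 - lam k 1 * (cnorm z)\<^sup>2)
            + (\<Sum>l=0..m-1. S_coeff k m l *
                (cnorm (cshift ((cdiff ^^ (l + 2)) z)
                  + complex_of_real (lam k 1) \<cdot>\<^sub>v (cdiff ^^ l) z))\<^sup>2));
         extremal = (z = finsum_vec TYPE(complex) k
           (\<lambda>\<nu>. fourier_coeff z \<nu> \<cdot>\<^sub>v fourier_vec k \<nu>) (low_freqs k (m + 1)))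
     in lhs1 \<le> rhs1 \<and> (lhs1 = rhs1 \<longleftrightarrow> extremal) \<and>
        lhs2 \<le> rhs2 \<and> (lhs2 = rhs2 \<longleftrightarrow> extremal) \<and>
        (extremal \<longleftrightarrow> (\<exists>a. z = finsum_vec TYPE(complex) k
           (\<lambda>\<nu>. a \<nu> \<cdot>\<^sub>v fourier_vec k \<nu>) (low_freqs k (m + 1))))"
proof -
  have k: "k > 0" and mk: "m + 1 < k" and m2: "2 * (m + 1) \<le> k"
    using assms(1,2) by presburger+
  note z = assms(3)
  let ?Pi = "\<lambda>n x. \<Prod>j=1..n. x - lam k j"
  define A where "A = spectral_form z (?Pi m)"
  define B where "B = spectral_form z (\<lambda>x. x * ?Pi m x)"
  define c where "c = lam k (m + 1)"
  define extremal where "extremal \<longleftrightarrow> (z = finsum_vec TYPE(complex) k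
           (\<lambda>\<nu>. fourier_coeff z \<nu> \<cdot>\<^sub>v fourier_vec k \<nu>) (low_freqs k (m + 1)))"
  have low: "low_freqs k (m + 1) \<subseteq> {..<k}"
    using mk by (auto simp: low_freqs_def)
  have lhs1: "(\<Sum>l=0..m. c_coeff k m l * (cnorm ((cdiff ^^ l) z))\<^sup>2) = A"
    using c_coeff_sum_spectral[OF z k, of m 0] by (simp add: A_def)
  have rhs1: "(\<Sum>l=0..m. c_coeff k m l * (cnorm ((cdiff ^^ (l + 1)) z))\<^sup>2) = B"
    using c_coeff_sum_spectral[OF z k, of m 1] by (simp only: B_def power_one_right)
  note lhs2 = S_coeff_sum_spectral[OF z k assms(1), folded A_def]
  note rhs2 = S_coeff_sum_spectral_step[OF z k assms(1), folded B_def]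
  have c: "c > 0"
    using lam_strict_mono[of 0 "m + 1" k] m2 by (simp add: c_def lam_def[of k 0])
  have mean: "fourier_coeff z 0 = 0"
    by (simp add: fourier_coeff_0[OF z] assms(4))
  have gap: "spectral_form z (?Pi (m + 1)) = B - c * A"
  proof -
    have "?Pi (m + 1) x = x * ?Pi m x - c * ?Pi m x" for x
      by (simp add: c_def algebra_simps)
    then show ?thesis
      by (simp only: A_def B_def spectral_form_diff spectral_form_scale)
  qed
  have le: "A \<le> 1 / c * B"
    using spectral_form_lam_prod(1)[OF z mk mean] gap c by (simp add: field_simps)
  have "A = 1 / c * B \<longleftrightarrow> B - c * A = 0"
    using c by (auto simp: field_simps)
  then have eq: "A = 1 / c * B \<longleftrightarrow> extremal"
    unfolding gap[symmetric] spectral_form_lam_prod(2)[OF z mk mean]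
      extremal_def fourier_synthesis_iff[OF z low] .
  have span: "extremal \<longleftrightarrow> (\<exists>a. z = finsum_vec TYPE(complex) k
           (\<lambda>\<nu>. a \<nu> \<cdot>\<^sub>v fourier_vec k \<nu>) (low_freqs k (m + 1)))" (is "_ \<longleftrightarrow> ?span")
  proof
    assume ?span
    then obtain a where a: "z = finsum_vec TYPE(complex) k
        (\<lambda>\<nu>. a \<nu> \<cdot>\<^sub>v fourier_vec k \<nu>) (low_freqs k (m + 1))" by blast
    have "fourier_coeff z \<nu> = 0" if "\<nu> < k" "\<nu> \<notin> low_freqs k (m + 1)" for \<nu>
      unfolding a fourier_coeff_linear_combination[OF low \<open>\<nu> < k\<close>] using that by simp
    then show extremal
      unfolding extremal_def fourier_synthesis_iff[OF z low] by blast
  qed (auto simp: extremal_def)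
  show ?thesis
    unfolding Let_def lhs1 rhs1 lhs2 rhs2 c_def[symmetric] extremal_def[symmetric]
    using le eq span by blast
qed

end
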